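(* Let $F=f+g$ on $\mathbb{R}^d$, where $f:\mathbb{R}^d\to\mathbb{R}$ is continuously differentiable and $L$-smooth, $g:\mathbb{R}^d\to\mathbb{R}\cup\{+\infty\}$ is proper, closed and convex, and the set $\mathcal{X}^*$ of minimizers of $F$ is nonempty with finite minimum value $F^*$. Let $\mathcal{K}\subseteq\mathbb{R}^d$. (i) If $F$ satisfies the $\mathcal{K}$-restricted proximal error bound with constant $\mu_{\mathcal{K}}>0$, then it satisfies the $\mathcal{K}$-restricted proximal PL inequality with constant $$\nu_{\mathcal{K}}=\frac{L}{1+4L^2\mu_{\mathcal{K}}^2}.$$ (ii) Conversely, suppose $F$ satisfies the $\mathcal{K}$-restricted proximal PL inequality with constant $\nu_{\mathcal{K}}>0$ and, in addition, that $\mathcal{K}$ is closed and that for every $\lambda\in(0,1/L]$ the proximal gradient update $x\mapsto x-\lambda\mathcal{G}_\lambda(x)$ maps $\mathcal{K}$ into itself. Then $F$ satisfies the $\mathcal{K}$-restricted proximal error bound with constant $$\mu_{\mathcal{K}}=\frac1L+\frac{2}{\nu_{\mathcal{K}}}.$$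
   Context: $L$-smooth (with $L>0$) means $\|\nabla f(x)-\nabla f(y)\|_2\le L\|x-y\|_2$ for all $x,y\in\mathbb{R}^d$. The function $f$ need not be convex. $\operatorname{dist}(x,\mathcal{X}^* )=\inf_{y\in\mathcal{X}^*}\|x-y\|_2$ and $\operatorname{dom}(F)=\{x: F(x)<+\infty\}$. For $\lambda>0$, $\operatorname{prox}_{\lambda g}(x):=\operatorname{argmin}_{y\in\mathbb{R}^d}\{g(y)+\frac{1}{2\lambda}\|y-x\|_2^2\}$, and the proximal gradient mapping is $$\mathcal{G}_\lambda(x):=\frac1\lambda\left(x-\operatorname{prox}_{\lambda g}(x-\lambda\nabla f(x))\right).$$ Generalized gradient size: for $\alpha>0$, $$\mathcal{D}_g(x,\alpha):=-2\alpha\min_{y\in\mathbb{R}^d}\left[\langle\nabla f(x),y-x\rangle+\frac{\alpha}{2}\|y-x\|_2^2+g(y)-g(x)\right].$$ $F$ satisfies the $\mathcal{K}$-restricted proximal PL inequality with constant $\nu_{\mathcal{K}}>0$ if $\frac12\mathcal{D}_g(x,L)\ge\nu_{\mathcal{K}}(F(x)-F^* )$ for all $x\in\mathcal{K}\cap\operatorname{dom}(F)$. $F$ satisfies the $\mathcal{K}$-restricted proximal error bound with constant $\mu_{\mathcal{K}}>0$ if $\operatorname{dist}(x,\mathcal{X}^* )\le\mu_{\mathcal{K}}\|\mathcal{G}_{1/L}(x)\|_2$ for all $x\in\mathcal{K}\cap\operatorname{dom}(F)$. *)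

theory Defs
  imports "HOL-Analysis.Analysis"
begin

text \<open>Extended-valued convex functions \<open>g\<close> have type \<open>'a \<Rightarrow> ereal\<close>; as usual, closedness and
  convexity are those of the epigraph. (The library constant \<open>epigraph\<close> is for real-valued
  functions only.)\<close>

definition ereal_epigraph :: "('a \<Rightarrow> ereal) \<Rightarrow> ('a \<times> real) set" where
  "ereal_epigraph g = {(x, r). g x \<le> ereal r}"

definition closed_fun :: "('a::topological_space \<Rightarrow> ereal) \<Rightarrow> bool" where
  "closed_fun g \<longleftrightarrow> closed (ereal_epigraph g)"

definition convex_fun :: "('a::real_vector \<Rightarrow> ereal) \<Rightarrow> bool" where
  "convex_fun g \<longleftrightarrow> convex (ereal_epigraph g)"

definition effective_dom :: "('a \<Rightarrow> ereal) \<Rightarrow> 'a set" where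
  "effective_dom F = {x. F x < \<infinity>}"

definition proper_fun :: "('a \<Rightarrow> ereal) \<Rightarrow> bool" where
  "proper_fun g \<longleftrightarrow> (\<forall>x. g x \<noteq> -\<infinity>) \<and> effective_dom g \<noteq> {}"

definition gradient :: "('a::euclidean_space \<Rightarrow> real) \<Rightarrow> 'a \<Rightarrow> 'a" where
  "gradient f x = (THE D. GDERIV f x :> D)"

definition continuously_differentiable :: "('a::euclidean_space \<Rightarrow> real) \<Rightarrow> bool" where
  "continuously_differentiable f \<longleftrightarrow>
     (\<forall>x. f differentiable (at x)) \<and> continuous_on UNIV (gradient f)"

definition smooth_fun :: "real \<Rightarrow> ('a::euclidean_space \<Rightarrow> real) \<Rightarrow> bool" where
  "smooth_fun L f \<longleftrightarrow> (\<forall>x y. norm (gradient f x - gradient f y) \<le> L * norm (x - y))"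

definition composite :: "('a \<Rightarrow> real) \<Rightarrow> ('a \<Rightarrow> ereal) \<Rightarrow> 'a \<Rightarrow> ereal" where
  "composite f g x = ereal (f x) + g x"

definition minimizers :: "('a \<Rightarrow> ereal) \<Rightarrow> 'a set" where
  "minimizers F = {x. is_arg_min F (\<lambda>_. True) x}"

definition min_value :: "('a \<Rightarrow> ereal) \<Rightarrow> ereal" where
  "min_value F = (INF x. F x)"

text \<open>For proper, closed, convex \<open>g\<close> and \<open>\<eta> > 0\<close> the minimizer below exists and is unique, so the
  choice made by \<open>arg_min\<close> is immaterial.\<close>

definition prox :: "real \<Rightarrow> ('a::euclidean_space \<Rightarrow> ereal) \<Rightarrow> 'a \<Rightarrow> 'a" where
  "prox \<eta> g x = arg_min (\<lambda>y. g y + ereal (1 / (2 * \<eta>) * (norm (y - x))\<^sup>2)) (\<lambda>_. True)"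

definition prox_grad_map ::
  "('a::euclidean_space \<Rightarrow> real) \<Rightarrow> ('a \<Rightarrow> ereal) \<Rightarrow> real \<Rightarrow> 'a \<Rightarrow> 'a" where
  "prox_grad_map f g \<eta> x = (1 / \<eta>) *\<^sub>R (x - prox \<eta> g (x - \<eta> *\<^sub>R gradient f x))"

text \<open>The generalized gradient size, meaningful for \<open>x\<close> with \<open>g x\<close> finite and \<open>\<alpha> > 0\<close>: there the
  minimum over \<open>y\<close> is attained and is the infimum below.\<close>

definition gen_grad_size ::
  "('a::euclidean_space \<Rightarrow> real) \<Rightarrow> ('a \<Rightarrow> ereal) \<Rightarrow> 'a \<Rightarrow> real \<Rightarrow> ereal" where
  "gen_grad_size f g x \<alpha> =
     ereal (- 2 * \<alpha>) *
       (INF y. ereal (gradient f x \<bullet> (y - x) + \<alpha> / 2 * (norm (y - x))\<^sup>2) + g y - g x)"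

definition restricted_prox_PL ::
  "('a::euclidean_space \<Rightarrow> real) \<Rightarrow> ('a \<Rightarrow> ereal) \<Rightarrow> real \<Rightarrow> 'a set \<Rightarrow> real \<Rightarrow> bool" where
  "restricted_prox_PL f g L K \<nu> \<longleftrightarrow> 0 < \<nu> \<and>
     (\<forall>x \<in> K \<inter> effective_dom (composite f g).
        ereal (1 / 2) * gen_grad_size f g x L
          \<ge> ereal \<nu> * (composite f g x - min_value (composite f g)))"

text \<open>Pitfall: \<open>infdist x {} = 0\<close>, so this is the intended notion only if minimizers exist.\<close>

definition restricted_prox_EB ::
  "('a::euclidean_space \<Rightarrow> real) \<Rightarrow> ('a \<Rightarrow> ereal) \<Rightarrow> real \<Rightarrow> 'a set \<Rightarrow> real \<Rightarrow> bool" where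
  "restricted_prox_EB f g L K \<mu> \<longleftrightarrow> 0 < \<mu> \<and>
     (\<forall>x \<in> K \<inter> effective_dom (composite f g).
        infdist x (minimizers (composite f g)) \<le> \<mu> * norm (prox_grad_map f g (1 / L) x))"

end

theory Submission
  imports Defs
begin

text \<open>
  Write \<open>x\<^sup>+\<close> for the proximal gradient step and \<open>D\<close> for the generalized gradient size at \<open>x\<close>.

  For (i), the descent lemma, applied towards the nearest minimizer \<open>y\<close>, bounds \<open>F x - F y\<close> by the
  model decrease \<open>D / (2 L)\<close> plus \<open>L \<parallel>x - y\<parallel>\<^sup>2\<close>; the error bound and \<open>\<parallel>G x\<parallel>\<^sup>2 \<le> D\<close> turn the second
  term into a multiple of \<open>D\<close>.

  For (ii), iterate steps of a fixed size \<open>\<eta> < 1 / L\<close>. One step decreases \<open>F\<close> by at least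
  \<open>\<eta> / 2 * D + (1 - L \<eta>) / (2 \<eta>) * \<parallel>x - x\<^sup>+\<parallel>\<^sup>2\<close>. By the PL inequality and AM-GM, the square root
  of the gap \<open>F - F\<^sup>*\<close> thus drops by at least \<open>sqrt (\<nu> / 2 * (1 - L \<eta>)) * \<parallel>x - x\<^sup>+\<parallel>\<close>, so the
  iterates have finite length and converge to a minimizer. Letting \<open>\<eta>\<close> tend to \<open>0\<close> gives the
  quadratic growth \<open>\<nu> / 2 * dist(x, X\<^sup>*)\<^sup>2 \<le> F x - F\<^sup>*\<close>; small steps are essential, since \<open>\<eta> = 1 / L\<close>
  loses a factor. Apply it at \<open>x\<^sup>+\<close> (step \<open>1 / L\<close>), where \<open>F\<close> has a subgradient of norm at most
  \<open>2 \<parallel>G x\<parallel>\<close>.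
\<close>

section \<open>Gradients and the descent lemma\<close>

text \<open>Since \<open>gradient\<close> is a definite description, both existence and uniqueness
  are needed. The Riesz vector of the derivative is \<open>adjoint f' 1\<close>; two candidates
  coincide by testing on their difference.\<close>

lemma gradient_has_derivative:
  assumes "f differentiable (at x)"
  shows "(f has_derivative (\<lambda>h. h \<bullet> gradient f x)) (at x)"
proof -
  obtain f' where f': "(f has_derivative f') (at x)"
    using assms unfolding differentiable_def by blast
  define D where "D = adjoint f' 1"
  have "f' = (\<lambda>h. h \<bullet> D)"
    using adjoint_works[OF has_derivative_linear[OF f'], of _ 1] by (simp add: D_def fun_eq_iff)
  then have D: "GDERIV f x :> D"
    using f' by (simp add: gderiv_def)
  have "E = D" if "GDERIV f x :> E" for E
  proof -
    have "(\<lambda>h. h \<bullet> E) = (\<lambda>h. h \<bullet> D)"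
      using that D unfolding gderiv_def by (rule has_derivative_unique)
    from fun_cong[OF this, of "E - D"] have "(E - D) \<bullet> (E - D) = 0"
      by (simp only: inner_diff_right)
    then show ?thesis by simp
  qed
  then have "gradient f x = D"
    unfolding gradient_def using D by (intro the_equality)
  with D show ?thesis by (simp add: gderiv_def)
qed

text \<open>Along the segment the directional derivative drifts from its initial value by at most
  \<open>t * L * (norm d)\<^sup>2\<close>. Both signs matter: the upper bound yields the decrease of
  a step, the lower one replaces convexity of \<open>f\<close> in \<open>gap_le\<close>.\<close>

lemma smooth_fun_descent:
  assumes diff: "\<And>z. f differentiable (at z)" and "smooth_fun L f"
  shows "\<bar>f y - f x - gradient f x \<bullet> (y - x)\<bar> \<le> L / 2 * (norm (y - x))\<^sup>2"
proof -
  define d where "d = y - x"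
  have der: "((\<lambda>t. f (x + t *\<^sub>R d)) has_real_derivative d \<bullet> gradient f (x + t *\<^sub>R d)) (at t)" for t
  proof -
    have "((\<lambda>t. x + t *\<^sub>R d) has_derivative (\<lambda>h. h *\<^sub>R d)) (at t)"
      by (auto intro!: derivative_eq_intros)
    from has_derivative_compose[OF this gradient_has_derivative[OF diff]]
    show ?thesis
      by (simp add: has_field_derivative_def mult_commute_abs)
  qed
  have grad: "\<bar>d \<bullet> gradient f (x + t *\<^sub>R d) - d \<bullet> gradient f x\<bar> \<le> t * L * (norm d)\<^sup>2"
    if "0 \<le> t" for t
  proof -
    have "\<bar>d \<bullet> gradient f (x + t *\<^sub>R d) - d \<bullet> gradient f x\<bar>
        \<le> norm d * norm (gradient f (x + t *\<^sub>R d) - gradient f x)"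
      using Cauchy_Schwarz_ineq2[of d "gradient f (x + t *\<^sub>R d) - gradient f x"]
      by (simp add: inner_diff_right)
    also have "\<dots> \<le> norm d * (L * norm (t *\<^sub>R d))"
      using assms(2)[unfolded smooth_fun_def, rule_format, of "x + t *\<^sub>R d" x]
      by (intro mult_left_mono) simp_all
    finally show ?thesis
      using that by (simp add: power2_eq_square mult_ac)
  qed
  \<comment> \<open>The sign treats both bounds at once. Subtracting the quadratic makes
    \<open>\<phi>\<close> nonincreasing, so a monotonicity argument takes the place of integrating
    the drift.\<close>
  have "\<sigma> * (f y - f x - d \<bullet> gradient f x) \<le> L / 2 * (norm d)\<^sup>2" if "\<bar>\<sigma>\<bar> = 1" for \<sigma> :: real
  proof -
    define \<phi> where
      "\<phi> t = \<sigma> * (f (x + t *\<^sub>R d) - t * (d \<bullet> gradient f x)) - t\<^sup>2 * (L / 2 * (norm d)\<^sup>2)" for t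
    have "\<phi> 1 \<le> \<phi> 0"
    proof (rule DERIV_nonpos_imp_nonincreasing[of 0 1 \<phi>])
      fix t :: real assume t: "0 \<le> t" "t \<le> 1"
      let ?D = "\<sigma> * (d \<bullet> gradient f (x + t *\<^sub>R d) - d \<bullet> gradient f x) - 2 * t * (L / 2 * (norm d)\<^sup>2)"
      have "DERIV \<phi> t :> ?D"
        unfolding \<phi>_def by (auto intro!: derivative_eq_intros der)
      moreover have "\<sigma> * (d \<bullet> gradient f (x + t *\<^sub>R d) - d \<bullet> gradient f x) \<le> t * L * (norm d)\<^sup>2"
        using grad[OF t(1)] that by (auto simp: abs_if split: if_splits)
      ultimately show "\<exists>D. DERIV \<phi> t :> D \<and> D \<le> 0"
        by (intro exI[of _ ?D]) (simp add: mult_ac)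
    qed simp
    then show ?thesis
      by (simp add: \<phi>_def d_def algebra_simps)
  qed
  from this[of 1] this[of "-1"] show ?thesis
    unfolding abs_le_iff by (simp add: d_def inner_commute)
qed

section \<open>Existence of proximal points\<close>

text \<open>A hyperplane separating a point below the graph from the epigraph cannot be vertical.\<close>

lemma affine_minorant:
  fixes g :: "'a::euclidean_space \<Rightarrow> ereal"
  assumes "proper_fun g" "closed_fun g" "convex_fun g"
  obtains a c where "\<And>y. ereal (c - a \<bullet> y) \<le> g y"
proof -
  obtain x0 where "x0 \<in> effective_dom g" and ninf: "\<And>x. g x \<noteq> -\<infinity>"
    using assms(1) by (auto simp: proper_fun_def)
  then obtain r0 where r0: "g x0 = ereal r0"
    by (cases "g x0") (auto simp: effective_dom_def)
  have "(x0, r0 - 1) \<notin> ereal_epigraph g"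
    by (simp add: ereal_epigraph_def r0)
  then obtain v b where lt: "v \<bullet> (x0, r0 - 1) < b" and gt: "\<And>z. z \<in> ereal_epigraph g \<Longrightarrow> b < v \<bullet> z"
    using separating_hyperplane_closed_point[of "ereal_epigraph g" "(x0, r0 - 1)"] assms(2,3)
    unfolding convex_fun_def closed_fun_def by metis
  obtain a \<beta> where v: "v = (a, \<beta>)" by (cases v)
  have "b < v \<bullet> (x0, r0)"
    by (intro gt) (simp add: ereal_epigraph_def r0)
  with lt have \<beta>: "0 < \<beta>" by (simp add: v inner_prod_def algebra_simps)
  show thesis
  proof (rule that[of "b / \<beta>" "a /\<^sub>R \<beta>"])
    fix y
    show "ereal (b / \<beta> - (a /\<^sub>R \<beta>) \<bullet> y) \<le> g y"
    proof (cases "g y")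
      case (real r)
      then have "b < v \<bullet> (y, r)"
        by (intro gt) (simp add: ereal_epigraph_def)
      then show ?thesis
        using \<beta> real by (simp add: v inner_prod_def field_simps)
    qed (use ninf in auto)
  qed
qed

text \<open>Minimizing over pairs \<open>(y, s)\<close> of the epigraph turns the extended-valued
  objective into a continuous real function on a closed set. Its sublevel set is compact because the
  affine minorant falls at most linearly while the proximal term grows quadratically.\<close>

lemma prox_minimizer_exists:
  fixes g :: "'a::euclidean_space \<Rightarrow> ereal"
  assumes "proper_fun g" "closed_fun g" "convex_fun g" "0 < \<eta>"
  obtains p r where "g p = ereal r"
    "\<And>y s. g y \<le> ereal s \<Longrightarrow>
       r + 1 / (2 * \<eta>) * (norm (p - z))\<^sup>2 \<le> s + 1 / (2 * \<eta>) * (norm (y - z))\<^sup>2"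
proof -
  obtain a c where minor: "\<And>y. ereal (c - a \<bullet> y) \<le> g y"
    using affine_minorant assms(1-3) by blast
  obtain x0 where "x0 \<in> effective_dom g" and ninf: "\<And>x. g x \<noteq> -\<infinity>"
    using assms(1) by (auto simp: proper_fun_def)
  then obtain r0 where r0: "g x0 = ereal r0"
    by (cases "g x0") (auto simp: effective_dom_def)
  define \<phi> where "\<phi> = (\<lambda>w::'a \<times> real. snd w + 1 / (2 * \<eta>) * (norm (fst w - z))\<^sup>2)"
  have cont: "continuous_on UNIV \<phi>"
    unfolding \<phi>_def by (intro continuous_intros)
  define C where "C = ereal_epigraph g \<inter> {w. \<phi> w \<le> \<phi> (x0, r0)}"
  have "closed C"
    unfolding C_def using assms(2) cont
    by (intro closed_Int closed_Collect_le continuous_on_const) (auto simp: closed_fun_def)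
  moreover have "bounded C"
  proof -
    define M where "M = \<bar>\<phi> (x0, r0)\<bar> + \<bar>c\<bar> + norm a * norm z"
    \<comment> \<open>With t the distance from \<open>y\<close> to \<open>z\<close>, the sublevel
      condition reads t^2 \<le> 2 \<eta> (|a| t + M). If t > 1, then M \<le> M t and division by t
      bounds t; the summand 1 covers the other case.\<close>
    define R where "R = 1 + 2 * \<eta> * (norm a + M)"
    have M: "0 \<le> M" by (simp add: M_def)
    have "C \<subseteq> cball z R \<times> {c - norm a * (norm z + R)..\<phi> (x0, r0)}"
    proof
      fix w assume "w \<in> C"
      obtain y s where w: "w = (y, s)" by (cases w)
      have "g y \<le> ereal s"
        using \<open>w \<in> C\<close> by (simp add: C_def ereal_epigraph_def w)
      with minor[of y] have "ereal (c - a \<bullet> y) \<le> ereal s" by (rule order_trans)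
      then have s: "c - a \<bullet> y \<le> s" by simp
      have le: "s + 1 / (2 * \<eta>) * (norm (y - z))\<^sup>2 \<le> \<phi> (x0, r0)"
        using \<open>w \<in> C\<close> unfolding C_def w by (auto simp: \<phi>_def)
      have "a \<bullet> y \<le> norm a * norm y" by (rule norm_cauchy_schwarz)
      moreover have ny: "norm a * norm y \<le> norm a * (norm z + norm (y - z))"
        by (intro mult_left_mono norm_triangle_sub) simp
      ultimately have "1 / (2 * \<eta>) * (norm (y - z))\<^sup>2 \<le> norm a * norm (y - z) + M"
        using s le by (simp add: M_def algebra_simps)
      then have q: "(norm (y - z))\<^sup>2 \<le> 2 * \<eta> * (norm a * norm (y - z) + M)"
        using assms(4) by (simp add: field_simps)
      have yz: "norm (y - z) \<le> R"
      proof (cases "norm (y - z) \<le> 1")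
        case True
        then show ?thesis using assms(4) M by (simp add: R_def add_increasing2)
      next
        case False
        have "norm (y - z) * norm (y - z) \<le> 2 * \<eta> * (norm a * norm (y - z) + M)"
          using q by (simp add: power2_eq_square)
        also have "\<dots> \<le> 2 * \<eta> * (norm a * norm (y - z) + M * norm (y - z))"
          using False M assms(4) by (intro mult_left_mono add_left_mono) (auto simp: mult_le_cancel_left1)
        also have "\<dots> = 2 * \<eta> * (norm a + M) * norm (y - z)"
          by (simp add: algebra_simps)
        finally have "norm (y - z) \<le> 2 * \<eta> * (norm a + M)"
          by (rule mult_right_le_imp_le) (use False in linarith)
        then show ?thesis by (simp add: R_def)
      qed
      have "norm a * (norm z + norm (y - z)) \<le> norm a * (norm z + R)"
        using yz by (intro mult_left_mono) auto
      moreover have "0 \<le> 1 / (2 * \<eta>) * (norm (y - z))\<^sup>2"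
        using assms(4) by simp
      ultimately show "w \<in> cball z R \<times> {c - norm a * (norm z + R)..\<phi> (x0, r0)}"
        using s le yz ny \<open>a \<bullet> y \<le> norm a * norm y\<close>
        by (auto simp: w dist_norm norm_minus_commute)
    qed
    then show ?thesis
      by (rule bounded_subset[rotated]) (intro bounded_Times bounded_cball bounded_closed_interval)
  qed
  ultimately have "compact C" by (simp add: compact_eq_bounded_closed)
  moreover have x0C: "(x0, r0) \<in> C"
    by (simp add: C_def ereal_epigraph_def r0)
  ultimately obtain w where w: "w \<in> C" "\<And>u. u \<in> C \<Longrightarrow> \<phi> w \<le> \<phi> u"
    using continuous_attains_inf[of C \<phi>] continuous_on_subset[OF cont] by blast
  obtain p r' where pr: "w = (p, r')" by (cases w)
  have "g p \<le> ereal r'" using w(1) by (simp add: C_def ereal_epigraph_def pr)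
  \<comment> \<open>The minimizing pair may a priori lie above the graph; lowering it to the graph
    preserves the inequality.\<close>
  then obtain r where r: "g p = ereal r" "r \<le> r'"
    using ninf[of p] by (cases "g p") auto
  show thesis
  proof (rule that[OF r(1)])
    fix y s assume ys: "g y \<le> ereal s"
    have "\<phi> w \<le> \<phi> (y, s)"
    proof (cases "\<phi> (y, s) \<le> \<phi> (x0, r0)")
      case True
      then show ?thesis using ys by (intro w(2)) (simp add: C_def ereal_epigraph_def)
    next
      case False
      then show ?thesis using w(2)[OF x0C] by linarith
    qed
    then show "r + 1 / (2 * \<eta>) * (norm (p - z))\<^sup>2 \<le> s + 1 / (2 * \<eta>) * (norm (y - z))\<^sup>2"
      using r(2) by (simp add: \<phi>_def pr)
  qed
qed

section \<open>Sequences of finite length\<close>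

text \<open>By telescoping, distances between terms are dominated by differences of
  \<open>a\<close>, which is monotone, bounded below and hence Cauchy.\<close>

lemma convergent_of_dist_le_decrease:
  fixes X :: "nat \<Rightarrow> 'a::complete_space"
  assumes "0 < c" and step: "\<And>n. c * dist (X n) (X (Suc n)) \<le> a n - a (Suc n)"
    and nonneg: "\<And>n. (0::real) \<le> a n"
  obtains l where "X \<longlonglongrightarrow> l" "c * dist (X 0) l \<le> a 0"
proof -
  have tele: "c * dist (X m) (X n) \<le> a m - a n" if "m \<le> n" for m n
    using that
  proof (induction n rule: dec_induct)
    case (step n)
    have "c * dist (X m) (X (Suc n)) \<le> c * (dist (X m) (X n) + dist (X n) (X (Suc n)))"
      using \<open>0 < c\<close> by (intro mult_left_mono dist_triangle) simp
    with step.IH assms(2)[of n] show ?case by (simp add: distrib_left)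
  qed simp
  have "decseq a"
  proof (rule decseq_SucI)
    fix n show "a (Suc n) \<le> a n"
      using step[of n] \<open>0 < c\<close> zero_le_dist[of "X n" "X (Suc n)"]
      by (smt (verit) mult_nonneg_nonneg)
  qed
  then obtain v where "a \<longlonglongrightarrow> v"
    using decseq_convergent[of a 0] nonneg by blast
  then have Ca: "Cauchy a" by (rule LIMSEQ_imp_Cauchy)
  have "Cauchy X"
  proof (rule metric_CauchyI)
    fix e :: real assume "0 < e"
    with Ca \<open>0 < c\<close> obtain N where N: "\<And>m n. N \<le> m \<Longrightarrow> N \<le> n \<Longrightarrow> dist (a m) (a n) < c * e"
      by (metis metric_CauchyD mult_pos_pos)
    have less: "dist (X m) (X n) < e" if "N \<le> m" "m \<le> n" for m n
    proof -
      have "c * dist (X m) (X n) \<le> a m - a n" using that(2) by (rule tele)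
      also have "\<dots> < c * e" using N[of m n] that by (simp add: dist_real_def abs_less_iff)
      finally show ?thesis using \<open>0 < c\<close> by simp
    qed
    show "\<exists>M. \<forall>m\<ge>M. \<forall>n\<ge>M. dist (X m) (X n) < e"
    proof (intro exI allI impI)
      fix m n assume "N \<le> m" "N \<le> n"
      then show "dist (X m) (X n) < e"
        using less[of m n] less[of n m] by (cases "m \<le> n") (auto simp: dist_commute)
    qed
  qed
  then obtain l where l: "X \<longlonglongrightarrow> l"
    by (meson Cauchy_convergent_iff convergent_def)
  have "(\<lambda>n. c * dist (X 0) (X n)) \<longlonglongrightarrow> c * dist (X 0) l"
    by (intro tendsto_intros l)
  then have "c * dist (X 0) l \<le> a 0"
  proof (rule LIMSEQ_le_const2, intro exI allI impI)
    fix n show "c * dist (X 0) (X n) \<le> a 0"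
      using tele[of 0 n] nonneg[of n] by simp
  qed
  with l show thesis by (rule that)
qed

section \<open>The composite problem in real-valued form\<close>

locale composite_objective =
  fixes f :: "'a::euclidean_space \<Rightarrow> real"
    and g :: "'a \<Rightarrow> ereal"
    and L :: real
  assumes L_pos: "0 < L"
    and cont_diff: "continuously_differentiable f"
    and smooth: "smooth_fun L f"
    and proper: "proper_fun g"
    and closed_g: "closed_fun g"
    and convex_g: "convex_fun g"
    and minimizers_nonempty: "minimizers (composite f g) \<noteq> {}"
begin

text \<open>Meaningful only on \<open>effective_dom g\<close>; elsewhere
  \<open>real_of_ereal\<close> sends infinity to 0, so the facts below carry domain
  hypotheses.\<close>

definition gr :: "'a \<Rightarrow> real" where
  "gr x = real_of_ereal (g x)"

definition Fr :: "'a \<Rightarrow> real" where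
  "Fr x = f x + gr x"

definition step :: "real \<Rightarrow> 'a \<Rightarrow> 'a" where
  "step \<eta> x = prox \<eta> g (x - \<eta> *\<^sub>R gradient f x)"

definition model :: "real \<Rightarrow> 'a \<Rightarrow> 'a \<Rightarrow> real" where
  "model \<eta> x y = gradient f x \<bullet> (y - x) + 1 / (2 * \<eta>) * (norm (y - x))\<^sup>2 + gr y - gr x"

text \<open>This is \<open>gen_grad_size\<close> at \<open>\<alpha> = 1 / \<eta>\<close>, with the
  minimum evaluated at its minimizer \<open>step \<eta> x\<close>; see
  \<open>gen_grad_size_eq\<close>.\<close>

definition grad_size :: "real \<Rightarrow> 'a \<Rightarrow> real" where
  "grad_size \<eta> x = - (2 / \<eta>) * model \<eta> x (step \<eta> x)"

lemma differentiable: "f differentiable (at x)"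
  using cont_diff by (simp add: continuously_differentiable_def)

lemma g_eq: "x \<in> effective_dom g \<Longrightarrow> g x = ereal (gr x)"
  using proper by (cases "g x") (auto simp: effective_dom_def gr_def proper_fun_def)

lemma composite_eq: "x \<in> effective_dom g \<Longrightarrow> composite f g x = ereal (Fr x)"
  by (simp add: composite_def Fr_def g_eq)

lemma not_dom: "x \<notin> effective_dom g \<Longrightarrow> g x = \<infinity>"
  by (simp add: effective_dom_def)

lemma effective_dom_composite [simp]: "effective_dom (composite f g) = effective_dom g"
proof -
  have "ereal (f x) + g x < \<infinity> \<longleftrightarrow> g x < \<infinity>" for x
    by (cases "g x") auto
  then show ?thesis by (simp add: effective_dom_def composite_def)
qed

lemma gr_convex:
  assumes "x \<in> effective_dom g" "y \<in> effective_dom g" "0 \<le> t" "t \<le> 1"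
  shows "x + t *\<^sub>R (y - x) \<in> effective_dom g"
    and "gr (x + t *\<^sub>R (y - x)) \<le> gr x + t * (gr y - gr x)"
proof -
  have "(x, gr x) \<in> ereal_epigraph g" "(y, gr y) \<in> ereal_epigraph g"
    using assms by (auto simp: ereal_epigraph_def g_eq)
  then have "(1 - t) *\<^sub>R (x, gr x) + t *\<^sub>R (y, gr y) \<in> ereal_epigraph g"
    using convex_g assms(3,4) by (intro convexD) (auto simp: convex_fun_def)
  moreover have "(1 - t) *\<^sub>R (x, gr x) + t *\<^sub>R (y, gr y)
      = (x + t *\<^sub>R (y - x), gr x + t * (gr y - gr x))"
    by (simp add: algebra_simps)
  ultimately have *: "g (x + t *\<^sub>R (y - x)) \<le> ereal (gr x + t * (gr y - gr x))"
    by (simp add: ereal_epigraph_def)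
  then show "x + t *\<^sub>R (y - x) \<in> effective_dom g"
    by (auto simp: effective_dom_def intro: le_less_trans)
  with * show "gr (x + t *\<^sub>R (y - x)) \<le> gr x + t * (gr y - gr x)"
    by (simp add: g_eq)
qed

text \<open>The extra term \<open>(norm (y - prox \<eta> g z))\<^sup>2\<close> beyond plain
  minimality comes from strong convexity of the proximal objective: compare the minimizer with
  points of the segment towards \<open>y\<close>.\<close>

lemma prox_optimal:
  assumes "0 < \<eta>"
  shows prox_in_dom: "prox \<eta> g z \<in> effective_dom g"
    and prox_le: "y \<in> effective_dom g \<Longrightarrow>
      gr (prox \<eta> g z) + 1 / (2 * \<eta>) * (norm (prox \<eta> g z - z))\<^sup>2
        + 1 / (2 * \<eta>) * (norm (y - prox \<eta> g z))\<^sup>2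
      \<le> gr y + 1 / (2 * \<eta>) * (norm (y - z))\<^sup>2"
proof -
  define h where "h y = g y + ereal (1 / (2 * \<eta>) * (norm (y - z))\<^sup>2)" for y
  define q where "q = prox \<eta> g z"
  obtain p r where p: "g p = ereal r"
    and min: "\<And>y s. g y \<le> ereal s \<Longrightarrow>
      r + 1 / (2 * \<eta>) * (norm (p - z))\<^sup>2 \<le> s + 1 / (2 * \<eta>) * (norm (y - z))\<^sup>2"
    using prox_minimizer_exists proper closed_g convex_g assms by blast
  have hp: "h p \<le> h y" for y
  proof (cases "y \<in> effective_dom g")
    case True
    then show ?thesis using min[of y "gr y"] by (simp add: h_def p g_eq)
  qed (simp add: h_def not_dom)
  have hq: "h q \<le> h y" for y
    unfolding q_def prox_def h_def[symmetric]
    by (rule arg_minI[where x = p]) (use hp in \<open>auto simp: not_less\<close>)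
  have q: "q \<in> effective_dom g"
    using hq[of p] not_dom[of q] by (cases "q \<in> effective_dom g") (auto simp: h_def p)
  have le: "gr q + 1 / (2 * \<eta>) * (norm (q - z))\<^sup>2 \<le> gr y + 1 / (2 * \<eta>) * (norm (y - z))\<^sup>2"
    if "y \<in> effective_dom g" for y
    using hq[of y] that q by (simp add: h_def g_eq)
  show "prox \<eta> g z \<in> effective_dom g" using q by (simp add: q_def)
  assume y: "y \<in> effective_dom g"
  have "1 / (2 * \<eta>) * (norm (y - q))\<^sup>2
      \<le> gr y + 1 / (2 * \<eta>) * (norm (y - z))\<^sup>2 - (gr q + 1 / (2 * \<eta>) * (norm (q - z))\<^sup>2)"
  \<comment> \<open>This replaces the limit t to 0: dividing the comparison at
    \<open>t = 1 - u\<close> by t leaves the factor u on the quadratic term, and u in (0, 1) is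
    arbitrary.\<close>
  proof (rule field_le_mult_one_interval)
    fix u :: real assume u: "0 < u" "u < 1"
    define t where "t = 1 - u"
    define w where "w = q + t *\<^sub>R (y - q)"
    have t: "0 < t" "t \<le> 1" using u by (auto simp: t_def)
    have w: "w \<in> effective_dom g" "gr w \<le> gr q + t * (gr y - gr q)"
      using gr_convex[OF q y, of t] t by (auto simp: w_def)
    have "(norm (w - z))\<^sup>2
        = (norm (q - z))\<^sup>2 + t * ((norm (y - z))\<^sup>2 - (norm (q - z))\<^sup>2 - u * (norm (y - q))\<^sup>2)"
      unfolding w_def t_def power2_norm_eq_inner
      by (simp add: inner_diff_left inner_diff_right inner_add_left inner_add_right inner_commute
          algebra_simps)
    then have "0 \<le> t * (gr y - gr q) + 1 / (2 * \<eta>) *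
        (t * ((norm (y - z))\<^sup>2 - (norm (q - z))\<^sup>2 - u * (norm (y - q))\<^sup>2))"
      using le[OF w(1)] w(2) by (simp add: distrib_left)
    also have "\<dots> = t * (gr y + 1 / (2 * \<eta>) * (norm (y - z))\<^sup>2
        - (gr q + 1 / (2 * \<eta>) * (norm (q - z))\<^sup>2) - u * (1 / (2 * \<eta>) * (norm (y - q))\<^sup>2))"
      by (simp add: algebra_simps)
    finally show "u * (1 / (2 * \<eta>) * (norm (y - q))\<^sup>2)
        \<le> gr y + 1 / (2 * \<eta>) * (norm (y - z))\<^sup>2 - (gr q + 1 / (2 * \<eta>) * (norm (q - z))\<^sup>2)"
      using t by (simp add: zero_le_mult_iff)
  qed
  then show "gr (prox \<eta> g z) + 1 / (2 * \<eta>) * (norm (prox \<eta> g z - z))\<^sup>2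
        + 1 / (2 * \<eta>) * (norm (y - prox \<eta> g z))\<^sup>2
      \<le> gr y + 1 / (2 * \<eta>) * (norm (y - z))\<^sup>2"
    by (simp add: q_def)
qed

section \<open>The proximal gradient step and its decrease of the objective\<close>

lemma step_in_dom: "0 < \<eta> \<Longrightarrow> step \<eta> x \<in> effective_dom g"
  unfolding step_def by (rule prox_in_dom)

text \<open>Completing the square: the proximal objective centred at the gradient step differs from
  \<open>model \<eta> x\<close> only by a constant, so \<open>prox_le\<close> transfers with its
  quadratic gain.\<close>

lemma model_step_le:
  assumes "0 < \<eta>" "y \<in> effective_dom g"
  shows "model \<eta> x (step \<eta> x) + 1 / (2 * \<eta>) * (norm (y - step \<eta> x))\<^sup>2 \<le> model \<eta> x y"
proof -
  have "1 / (2 * \<eta>) * (norm (w - (x - \<eta> *\<^sub>R gradient f x)))\<^sup>2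
      = 1 / (2 * \<eta>) * (norm (w - x))\<^sup>2 + gradient f x \<bullet> (w - x) + \<eta> / 2 * (norm (gradient f x))\<^sup>2"
    for w
  proof -
    have "(norm (w - (x - \<eta> *\<^sub>R gradient f x)))\<^sup>2
      = (norm (w - x))\<^sup>2 + 2 * \<eta> * (gradient f x \<bullet> (w - x)) + \<eta>\<^sup>2 * (norm (gradient f x))\<^sup>2"
      unfolding power2_norm_eq_inner
      by (simp add: inner_diff_left inner_diff_right inner_add_left inner_add_right inner_commute
          algebra_simps power2_eq_square)
    then show ?thesis using assms(1) by (simp add: field_simps power2_eq_square)
  qed
  with prox_le[OF assms, of "x - \<eta> *\<^sub>R gradient f x"] show ?thesis
    by (simp add: model_def step_def)
qed

lemma gen_grad_size_eq:
  assumes "0 < \<eta>" "x \<in> effective_dom g"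
  shows "gen_grad_size f g x (1 / \<eta>) = ereal (grad_size \<eta> x)"
proof -
  let ?q = "\<lambda>y. ereal (gradient f x \<bullet> (y - x) + 1 / \<eta> / 2 * (norm (y - x))\<^sup>2) + g y - g x"
  have q: "?q y = ereal (model \<eta> x y)" if "y \<in> effective_dom g" for y
    using that assms(2) by (simp add: model_def g_eq mult.commute)
  have "(INF y. ?q y) = ereal (model \<eta> x (step \<eta> x))"
  proof (rule antisym)
    show "(INF y. ?q y) \<le> ereal (model \<eta> x (step \<eta> x))"
      by (rule INF_lower2[of "step \<eta> x"]) (simp_all only: q step_in_dom assms UNIV_I order_refl)
    show "ereal (model \<eta> x (step \<eta> x)) \<le> (INF y. ?q y)"
    proof (rule INF_greatest)
      fix y
      show "ereal (model \<eta> x (step \<eta> x)) \<le> ?q y"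
      proof (cases "y \<in> effective_dom g")
        case True
        have "0 \<le> 1 / (2 * \<eta>) * (norm (y - step \<eta> x))\<^sup>2" using assms(1) by simp
        with model_step_le[OF assms(1) True, of x] have "model \<eta> x (step \<eta> x) \<le> model \<eta> x y"
          by linarith
        then show ?thesis by (simp only: q[OF True] ereal_less_eq)
      qed (simp add: not_dom g_eq assms(2))
    qed
  qed
  then show ?thesis unfolding gen_grad_size_def by (simp add: grad_size_def)
qed

text \<open>Compare the step with staying put, where the model vanishes. For
  \<open>\<eta> = 1 / L\<close> this says that the squared norm of the proximal gradient mapping is
  at most the gradient size.\<close>

lemma norm_step_le_grad_size:
  assumes "0 < \<eta>" "x \<in> effective_dom g"
  shows "(norm (x - step \<eta> x))\<^sup>2 \<le> \<eta>\<^sup>2 * grad_size \<eta> x"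
  using model_step_le[OF assms, of x] assms(1)
  by (simp add: grad_size_def model_def[of _ x x] power2_eq_square field_simps)

text \<open>Move only the fraction \<open>\<eta> / \<zeta>\<close> of the way to the
  \<open>\<zeta>\<close>-step. This carries the PL inequality, stated for \<open>1 / L\<close>, over
  to smaller step sizes.\<close>

lemma grad_size_antimono:
  assumes "0 < \<eta>" "\<eta> \<le> \<zeta>" "x \<in> effective_dom g"
  shows "grad_size \<zeta> x \<le> grad_size \<eta> x"
proof -
  define p t where "p = step \<zeta> x" and "t = \<eta> / \<zeta>"
  have \<zeta>: "0 < \<zeta>" using assms by linarith
  have t: "0 \<le> t" "t \<le> 1" and \<eta>: "\<eta> = t * \<zeta>" using assms \<zeta> by (auto simp: t_def)
  define y where "y = x + t *\<^sub>R (p - x)"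
  have p: "p \<in> effective_dom g" unfolding p_def using \<zeta> by (rule step_in_dom)
  have y: "y \<in> effective_dom g" and gy: "gr y \<le> gr x + t * (gr p - gr x)"
    using gr_convex[OF assms(3) p t] by (auto simp: y_def)
  \<comment> \<open>The squared norm shrinks by t^2 while the coefficient grows by 1/t, so the
    quadratic term scales by t like the linear one, and convexity treats \<open>gr\<close>
    alike.\<close>
  have "1 / (2 * \<eta>) * (norm (y - x))\<^sup>2 = t * (1 / (2 * \<zeta>) * (norm (p - x))\<^sup>2)"
    using assms(1) t(1) by (auto simp: y_def \<eta> power2_eq_square zero_less_mult_iff)
  then have "model \<eta> x y \<le> t * model \<zeta> x p"
    using gy by (simp add: model_def y_def algebra_simps)
  moreover have "model \<eta> x (step \<eta> x) \<le> model \<eta> x y"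
    using model_step_le[OF assms(1) y, of x] assms(1)
    by (smt (verit) divide_nonneg_nonneg mult_nonneg_nonneg zero_le_power2)
  ultimately have "2 / \<eta> * model \<eta> x (step \<eta> x) \<le> 2 / \<eta> * (t * model \<zeta> x p)"
    using assms(1) by (intro mult_left_mono) auto
  also have "\<dots> = 2 / \<zeta> * model \<zeta> x p"
    using assms(1) \<zeta> by (simp add: t_def)
  finally show ?thesis by (simp add: grad_size_def p_def)
qed

text \<open>The descent lemma has curvature L where the model has 1/\<eta>; the difference of the
  two quadratic terms is the second summand.\<close>

lemma step_decrease:
  assumes "0 < \<eta>" "x \<in> effective_dom g"
  shows "\<eta> / 2 * grad_size \<eta> x + (1 / (2 * \<eta>) - L / 2) * (norm (x - step \<eta> x))\<^sup>2
    \<le> Fr x - Fr (step \<eta> x)"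
  using abs_le_D1[OF smooth_fun_descent[OF differentiable smooth, of "step \<eta> x" x]] assms(1)
  by (simp add: grad_size_def model_def Fr_def norm_minus_commute algebra_simps)

text \<open>The coefficient L is L/2 from the lower descent bound, the price of nonconvex
  \<open>f\<close>, plus L/2 from the quadratic term of the model at \<open>y\<close>.\<close>

lemma gap_le:
  assumes "x \<in> effective_dom g" "y \<in> effective_dom g"
  shows "Fr x - Fr y \<le> grad_size (1 / L) x / (2 * L) + L * (norm (x - y))\<^sup>2"
proof -
  have "0 \<le> L * (norm (y - step (1 / L) x))\<^sup>2" using L_pos by simp
  moreover have "model (1 / L) x (step (1 / L) x) = - grad_size (1 / L) x / (2 * L)"
    using L_pos by (simp add: grad_size_def)
  ultimately have "- grad_size (1 / L) x / (2 * L) \<le> model (1 / L) x y"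
    using model_step_le[of "1 / L" y x] L_pos assms(2)
    by (simp; linarith)
  then show ?thesis
    using abs_le_D2[OF smooth_fun_descent[OF differentiable smooth, of y x]]
    by (simp add: model_def Fr_def norm_minus_commute[of y x])
qed

lemma grad_size_step_le:
  assumes "x \<in> effective_dom g"
  shows "grad_size (1 / L) (step (1 / L) x) \<le> 4 * (norm (prox_grad_map f g (1 / L) x))\<^sup>2"
proof -
  define G p q where "G = prox_grad_map f g (1 / L) x" and "p = step (1 / L) x"
    and "q = step (1 / L) p"
  have G: "G = L *\<^sub>R (x - p)" by (simp add: G_def p_def step_def prox_grad_map_def)
  \<comment> \<open>\<open>G - gradient f x\<close> is a subgradient of \<open>g\<close> at
    \<open>p\<close> by optimality of the step, so v plays the role of a subgradient of the
    objective at \<open>p\<close>.\<close>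
  define v where "v = gradient f p - gradient f x + G"
  have q: "q \<in> effective_dom g" unfolding q_def using L_pos by (intro step_in_dom) simp
  \<comment> \<open>The subgradient inequality is needed only towards \<open>q\<close>. Expanding
    \<open>(norm (q - x))\<^sup>2\<close> around \<open>p\<close>, the quadratic gain in
    \<open>model_step_le\<close> cancels every remaining square.\<close>
  have sub: "(G - gradient f x) \<bullet> (q - p) \<le> gr q - gr p"
  proof -
    have "(norm (q - x))\<^sup>2 = (norm (q - p))\<^sup>2 + 2 * ((q - p) \<bullet> (p - x)) + (norm (p - x))\<^sup>2"
      unfolding power2_norm_eq_inner
      by (simp add: inner_diff_left inner_diff_right inner_commute)
    moreover have "G \<bullet> (q - p) = - L * ((q - p) \<bullet> (p - x))"
      by (simp add: G inner_diff_left inner_diff_right inner_commute algebra_simps)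
    ultimately have "L / 2 * (norm (q - x))\<^sup>2
        = L / 2 * (norm (q - p))\<^sup>2 - G \<bullet> (q - p) + L / 2 * (norm (p - x))\<^sup>2"
      by (simp add: distrib_left)
    with model_step_le[of "1 / L" q x] L_pos q show ?thesis
      by (simp add: model_def p_def[symmetric] inner_diff_left inner_diff_right field_simps)
  qed
  have "norm v \<le> norm (gradient f p - gradient f x) + norm G"
    unfolding v_def by (rule norm_triangle_ineq)
  also have "norm (gradient f p - gradient f x) \<le> L * norm (p - x)"
    using smooth by (simp add: smooth_fun_def)
  also have "\<dots> = norm G" using L_pos by (simp add: G norm_minus_commute)
  finally have v: "norm v \<le> 2 * norm G" by simp
  \<comment> \<open>Completing the square bounds the model at \<open>p\<close> below by -|v|^2 / (2
    L).\<close>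
  have "0 \<le> (norm (v + L *\<^sub>R (q - p)))\<^sup>2" by simp
  also have "\<dots> = (norm v)\<^sup>2 + 2 * L * (v \<bullet> (q - p) + L / 2 * (norm (q - p))\<^sup>2)"
    unfolding power2_norm_eq_inner
    by (simp add: inner_add_left inner_add_right inner_diff_left inner_diff_right inner_commute
        algebra_simps)
  also have "\<dots> \<le> (norm v)\<^sup>2 + 2 * L * model (1 / L) p q"
    using sub L_pos
    by (intro add_left_mono mult_left_mono) (auto simp: v_def model_def inner_add_left inner_diff_left)
  also have "\<dots> = (norm v)\<^sup>2 - grad_size (1 / L) p"
    by (simp add: grad_size_def q_def)
  finally have "grad_size (1 / L) p \<le> (norm v)\<^sup>2" by simp
  also have "\<dots> \<le> (2 * norm G)\<^sup>2" using v by (intro power_mono) auto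
  finally show ?thesis by (simp add: G_def p_def power_mult_distrib)
qed

text \<open>Lower semicontinuity through the closed epigraph: the graph points of \<open>g\<close>
  over the sequence converge, their heights being \<open>Fr (X n) - f (X n)\<close> with
  \<open>f\<close> continuous.\<close>

lemma limit_le:
  assumes "\<And>n. X n \<in> effective_dom g" "X \<longlonglongrightarrow> l" "(\<lambda>n. Fr (X n)) \<longlonglongrightarrow> v"
  shows "l \<in> effective_dom g" and "Fr l \<le> v"
proof -
  have "isCont f l" using differentiable by (rule differentiable_imp_continuous_within)
  then have "(\<lambda>n. f (X n)) \<longlonglongrightarrow> f l" using assms(2) by (rule isCont_tendsto_compose)
  then have lim: "(\<lambda>n. (X n, Fr (X n) - f (X n))) \<longlonglongrightarrow> (l, v - f l)"
    by (intro tendsto_intros assms)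
  have "(X n, Fr (X n) - f (X n)) \<in> ereal_epigraph g" for n
    using assms(1)[of n] by (simp add: ereal_epigraph_def Fr_def g_eq)
  with closed_g[unfolded closed_fun_def] have "(l, v - f l) \<in> ereal_epigraph g"
    using lim by (rule closed_sequentially)
  then have le: "g l \<le> ereal (v - f l)" by (simp add: ereal_epigraph_def)
  then show "l \<in> effective_dom g" by (auto simp: effective_dom_def intro: le_less_trans)
  with le show "Fr l \<le> v" by (simp add: g_eq Fr_def)
qed

section \<open>The minimum value and the set of minimizers\<close>

definition Fmin :: real where
  "Fmin = real_of_ereal (min_value (composite f g))"

lemma minimum:
  shows minimizers_eq: "minimizers (composite f g) = {x \<in> effective_dom g. Fr x \<le> Fmin}"
    and min_value_eq: "min_value (composite f g) = ereal Fmin"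
    and Fmin_le: "x \<in> effective_dom g \<Longrightarrow> Fmin \<le> Fr x"
proof -
  obtain xs where xs: "\<And>y. composite f g xs \<le> composite f g y"
    using minimizers_nonempty by (auto simp: minimizers_def is_arg_min_def not_less)
  obtain x0 where x0: "x0 \<in> effective_dom g" using proper by (auto simp: proper_fun_def)
  have "composite f g xs < \<infinity>"
    using xs[of x0] by (auto simp: composite_eq[OF x0] intro: le_less_trans)
  then have dom: "xs \<in> effective_dom g"
    using effective_dom_composite by (auto simp: effective_dom_def)
  have "min_value (composite f g) = composite f g xs"
    unfolding min_value_def by (rule antisym) (auto intro: INF_lower INF_greatest xs)
  then show min: "min_value (composite f g) = ereal Fmin"
    by (simp add: Fmin_def composite_eq dom)
  have le: "ereal Fmin \<le> composite f g y" for y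
    unfolding min[symmetric] min_value_def by (rule INF_lower) simp
  then show "Fmin \<le> Fr x" if "x \<in> effective_dom g"
    using that le[of x] by (simp add: composite_eq)
  have "x \<in> minimizers (composite f g) \<longleftrightarrow> composite f g x \<le> ereal Fmin" for x
    using le_INF_iff[of "composite f g x" "composite f g" UNIV] min
    by (simp add: minimizers_def is_arg_min_def min_value_def not_less)
  moreover have "composite f g x \<le> ereal Fmin \<longleftrightarrow> x \<in> effective_dom g \<and> Fr x \<le> Fmin" for x
    using not_dom[of x] by (cases "x \<in> effective_dom g") (simp_all add: composite_eq, simp add: composite_def)
  ultimately show "minimizers (composite f g) = {x \<in> effective_dom g. Fr x \<le> Fmin}" by blast
qed

lemma restricted_prox_PL_iff:
  "restricted_prox_PL f g L K \<nu> \<longleftrightarrow>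
    0 < \<nu> \<and> (\<forall>x \<in> K \<inter> effective_dom g. \<nu> * (Fr x - Fmin) \<le> grad_size (1 / L) x / 2)"
proof -
  have "gen_grad_size f g x L = ereal (grad_size (1 / L) x)" if "x \<in> effective_dom g" for x
    using gen_grad_size_eq[of "1 / L" x] that L_pos by simp
  then show ?thesis
    unfolding restricted_prox_PL_def by (auto simp: composite_eq min_value_eq)
qed

text \<open>Ensures that the distance to the minimizers is attained; on a sequence of minimizers the
  values are constantly \<open>Fmin\<close>, so \<open>limit_le\<close> applies.\<close>

lemma closed_minimizers: "closed (minimizers (composite f g))"
  unfolding closed_sequential_limits
proof (intro allI impI, elim conjE)
  fix X l assume X: "\<forall>n. X n \<in> minimizers (composite f g)" and l: "X \<longlonglongrightarrow> l"
  then have X': "X n \<in> effective_dom g" "Fr (X n) = Fmin" for n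
    using Fmin_le[of "X n"] by (auto simp: minimizers_eq intro: antisym)
  show "l \<in> minimizers (composite f g)"
    using limit_le[OF X'(1) l, of Fmin] by (simp add: X'(2) minimizers_eq)
qed

section \<open>From the error bound to the PL inequality\<close>

lemma prox_EB_imp_prox_PL:
  assumes "restricted_prox_EB f g L K \<mu>"
  shows "restricted_prox_PL f g L K (L / (1 + 4 * L\<^sup>2 * \<mu>\<^sup>2))"
  unfolding restricted_prox_PL_iff
proof (intro conjI ballI)
  have den: "0 < 1 + 4 * L\<^sup>2 * \<mu>\<^sup>2" by (simp add: add_pos_nonneg)
  then show "0 < L / (1 + 4 * L\<^sup>2 * \<mu>\<^sup>2)" using L_pos by simp
  fix x assume x: "x \<in> K \<inter> effective_dom g"
  define D where "D = grad_size (1 / L) x"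
  obtain y where y: "y \<in> minimizers (composite f g)" "infdist x (minimizers (composite f g)) = dist x y"
    using infdist_attains_inf closed_minimizers minimizers_nonempty by blast
  have "infdist x (minimizers (composite f g)) \<le> \<mu> * norm (prox_grad_map f g (1 / L) x)"
    using assms x by (simp add: restricted_prox_EB_def)
  then have "norm (x - y) \<le> \<mu> * norm (prox_grad_map f g (1 / L) x)"
    by (simp only: y(2) dist_norm)
  then have "(norm (x - y))\<^sup>2 \<le> \<mu>\<^sup>2 * (norm (prox_grad_map f g (1 / L) x))\<^sup>2"
    unfolding power_mult_distrib[symmetric] by (rule power_mono) simp
  also have "(norm (prox_grad_map f g (1 / L) x))\<^sup>2 = L\<^sup>2 * (norm (x - step (1 / L) x))\<^sup>2"
    by (simp add: prox_grad_map_def step_def power_mult_distrib)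
  also have "\<dots> \<le> D"
    using norm_step_le_grad_size[of "1 / L" x] x L_pos
    by (simp add: D_def power_divide field_simps)
  finally have dist: "(norm (x - y))\<^sup>2 \<le> \<mu>\<^sup>2 * D" by (simp add: mult_left_mono)
  have D: "0 \<le> D"
    using order_trans[OF zero_le_power2 norm_step_le_grad_size[of "1 / L" x]] x L_pos
    by (simp add: D_def zero_le_mult_iff)
  have "Fr y \<le> Fmin" "y \<in> effective_dom g" using y(1) by (auto simp: minimizers_eq)
  then have "Fr x - Fmin \<le> D / (2 * L) + L * (norm (x - y))\<^sup>2"
    using gap_le[of x y] x by (auto simp: D_def)
  also have "\<dots> \<le> D / (2 * L) + L * (\<mu>\<^sup>2 * D)"
    using dist L_pos by (intro add_left_mono mult_left_mono) auto
  \<comment> \<open>The estimate so far would give 1 + 2 L^2 \<mu>^2; doubling the second term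
    weakens it to the stated denominator.\<close>
  also have "\<dots> \<le> D / (2 * L) + 2 * (L * (\<mu>\<^sup>2 * D))"
    using D L_pos by simp
  also have "\<dots> = (1 + 4 * L\<^sup>2 * \<mu>\<^sup>2) / L * (D / 2)"
    using L_pos by (simp add: field_simps power2_eq_square)
  finally show "L / (1 + 4 * L\<^sup>2 * \<mu>\<^sup>2) * (Fr x - Fmin) \<le> grad_size (1 / L) x / 2"
    using den L_pos by (simp add: D_def field_simps)
qed

section \<open>From the PL inequality to the error bound via quadratic growth\<close>

text \<open>The first estimate drives the gap to zero along the iterates; the second makes their
  path length finite, with the root of the gap as potential.\<close>

lemma sqrt_gap_decrease:
  assumes x: "x \<in> effective_dom g" and "0 < \<nu>"
    and PL: "\<nu> * (Fr x - Fmin) \<le> grad_size (1 / L) x / 2"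
    and \<eta>: "0 < \<eta>" "\<eta> < 1 / L"
  shows "\<eta> * \<nu> * (Fr x - Fmin) \<le> Fr x - Fr (step \<eta> x)"
    and "sqrt (\<nu> / 2 * (1 - L * \<eta>)) * dist x (step \<eta> x)
      \<le> sqrt (Fr x - Fmin) - sqrt (Fr (step \<eta> x) - Fmin)"
proof -
  define a b c d where "a = sqrt (Fr x - Fmin)" and "b = sqrt (Fr (step \<eta> x) - Fmin)"
    and "c = sqrt (\<nu> / 2 * (1 - L * \<eta>))" and "d = dist x (step \<eta> x)"
  have z: "0 < 1 - L * \<eta>" using \<eta> L_pos by (simp add: field_simps)
  have a: "0 \<le> a" "a\<^sup>2 = Fr x - Fmin" using Fmin_le[OF x] by (auto simp: a_def)
  have b: "0 \<le> b" "b\<^sup>2 = Fr (step \<eta> x) - Fmin"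
    using Fmin_le[OF step_in_dom[OF \<eta>(1)]] by (auto simp: b_def)
  have c: "0 < c" "c\<^sup>2 = \<nu> / 2 * (1 - L * \<eta>)" using z \<open>0 < \<nu>\<close> by (auto simp: c_def)
  have "2 * \<nu> * a\<^sup>2 \<le> grad_size \<eta> x"
    using PL grad_size_antimono[of \<eta> "1 / L" x] \<eta> x by (simp add: a(2))
  then have "\<eta> * \<nu> * a\<^sup>2 \<le> \<eta> / 2 * grad_size \<eta> x"
    using \<eta>(1) by simp
  \<comment> \<open>The constant c is chosen so that c^2 / (\<eta> \<nu>) is the coefficient (1 - L
    \<eta>) / (2 \<eta>) of the squared step; the AM-GM product of the two decrease terms is then
    free of \<eta> and \<nu>.\<close>
  moreover have "(1 / (2 * \<eta>) - L / 2) * d\<^sup>2 = (c * d)\<^sup>2 / (\<eta> * \<nu>)"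
    using \<eta>(1) \<open>0 < \<nu>\<close> by (simp add: c(2) power_mult_distrib field_simps)
  ultimately have dec: "\<eta> * \<nu> * a\<^sup>2 + (c * d)\<^sup>2 / (\<eta> * \<nu>) \<le> a\<^sup>2 - b\<^sup>2"
    using step_decrease[OF \<eta>(1) x] by (simp add: a(2) b(2) d_def dist_norm)
  have "0 \<le> (c * d)\<^sup>2 / (\<eta> * \<nu>)" using \<eta>(1) \<open>0 < \<nu>\<close> by simp
  with dec show "\<eta> * \<nu> * (Fr x - Fmin) \<le> Fr x - Fr (step \<eta> x)"
    by (simp add: a(2) b(2))
  have "c * d \<le> a - b"
  \<comment> \<open>The main case divides by 2 a; at zero gap the decrease forces b and d to
    vanish.\<close>
  proof (cases "a = 0")
    case True
    have "(c * d)\<^sup>2 / (\<eta> * \<nu>) + b\<^sup>2 \<le> 0" using dec True by simp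
    with \<open>0 \<le> (c * d)\<^sup>2 / (\<eta> * \<nu>)\<close> have "b\<^sup>2 = 0" "(c * d)\<^sup>2 / (\<eta> * \<nu>) = 0"
      using zero_le_power2[of b] by linarith+
    then show ?thesis using True \<eta>(1) \<open>0 < \<nu>\<close> by auto
  next
    case False
    have "0 \<le> (\<eta> * \<nu> * a - c * d)\<^sup>2 / (\<eta> * \<nu>)" using \<eta>(1) \<open>0 < \<nu>\<close> by simp
    also have "\<dots> = \<eta> * \<nu> * a\<^sup>2 + (c * d)\<^sup>2 / (\<eta> * \<nu>) - 2 * a * (c * d)"
      using \<eta>(1) \<open>0 < \<nu>\<close> by (simp add: power2_diff power2_eq_square field_simps)
    finally have "2 * a * (c * d) \<le> a\<^sup>2 - b\<^sup>2" using dec by linarith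
    also have "\<dots> \<le> 2 * a * (a - b)"
      using zero_le_power2[of "a - b"] by (simp add: power2_eq_square algebra_simps)
    finally show ?thesis using False a(1) by simp
  qed
  then show "sqrt (\<nu> / 2 * (1 - L * \<eta>)) * dist x (step \<eta> x)
      \<le> sqrt (Fr x - Fmin) - sqrt (Fr (step \<eta> x) - Fmin)"
    by (simp add: a_def b_def c_def d_def)
qed

lemma quadratic_growth:
  assumes PL: "restricted_prox_PL f g L K \<nu>"
    and inv: "\<And>\<eta> x. 0 < \<eta> \<Longrightarrow> \<eta> \<le> 1 / L \<Longrightarrow> x \<in> K \<Longrightarrow> step \<eta> x \<in> K"
    and x: "x \<in> K" "x \<in> effective_dom g"
  shows "\<nu> / 2 * (infdist x (minimizers (composite f g)))\<^sup>2 \<le> Fr x - Fmin"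
\<comment> \<open>The factor z is the loss 1 - L \<eta> of a fixed step size, so letting z tend to 1
  sends \<eta> to 0.\<close>
proof (rule field_le_mult_one_interval)
  fix z :: real assume z: "0 < z" "z < 1"
  define \<eta> where "\<eta> = (1 - z) / L"
  have \<eta>: "0 < \<eta>" "\<eta> < 1 / L" "1 - L * \<eta> = z"
    using z L_pos by (auto simp: \<eta>_def field_simps)
  have \<nu>: "0 < \<nu>" using PL by (simp add: restricted_prox_PL_iff)
  define X where "X n = (step \<eta> ^^ n) x" for n
  have X_Suc: "X (Suc n) = step \<eta> (X n)" for n by (simp add: X_def)
  have X: "X n \<in> K" "X n \<in> effective_dom g" for n
    by (induction n) (use x \<eta> in \<open>auto simp: X_def intro: inv step_in_dom\<close>)
  have X_PL: "\<nu> * (Fr (X n) - Fmin) \<le> grad_size (1 / L) (X n) / 2" for n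
    using PL X by (simp add: restricted_prox_PL_iff)
  define c where "c = sqrt (\<nu> / 2 * z)"
  have c: "0 < c" "c\<^sup>2 = \<nu> / 2 * z" using z \<nu> by (auto simp: c_def)
  have gap: "\<eta> * \<nu> * (Fr (X n) - Fmin) \<le> Fr (X n) - Fr (X (Suc n))" for n
    unfolding X_Suc using sqrt_gap_decrease(1)[OF X(2) \<nu> X_PL \<eta>(1,2)] .
  have len: "c * dist (X n) (X (Suc n)) \<le> sqrt (Fr (X n) - Fmin) - sqrt (Fr (X (Suc n)) - Fmin)"
    for n
    using sqrt_gap_decrease(2)[OF X(2) \<nu> X_PL \<eta>(1,2), of n] by (simp add: X_Suc c_def \<eta>(3))
  obtain l where l: "X \<longlonglongrightarrow> l" "c * dist (X 0) l \<le> sqrt (Fr (X 0) - Fmin)"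
    using convergent_of_dist_le_decrease[where X = X and a = "\<lambda>n. sqrt (Fr (X n) - Fmin)", OF c(1) len]
      Fmin_le[OF X(2)] by auto
  have "decseq (\<lambda>n. Fr (X n))"
  proof (rule decseq_SucI)
    fix n
    have "0 \<le> \<eta> * \<nu> * (Fr (X n) - Fmin)" using \<eta>(1) \<nu> Fmin_le[OF X(2)] by simp
    with gap[of n] show "Fr (X (Suc n)) \<le> Fr (X n)" by linarith
  qed
  then obtain v where v: "(\<lambda>n. Fr (X n)) \<longlonglongrightarrow> v"
    using decseq_convergent[of "\<lambda>n. Fr (X n)" Fmin] Fmin_le[OF X(2)] by blast
  \<comment> \<open>In the limit the decrease per step vanishes, which forces the limiting value
    down to the minimum.\<close>
  have "(\<lambda>n. \<eta> * \<nu> * (Fr (X n) - Fmin)) \<longlonglongrightarrow> \<eta> * \<nu> * (v - Fmin)"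
    by (intro tendsto_intros v)
  moreover have "(\<lambda>n. Fr (X n) - Fr (X (Suc n))) \<longlonglongrightarrow> v - v"
    by (intro tendsto_diff v LIMSEQ_Suc[OF v])
  ultimately have "\<eta> * \<nu> * (v - Fmin) \<le> v - v"
    by (rule LIMSEQ_le) (use gap in blast)
  then have "v \<le> Fmin" using \<eta>(1) \<nu> by (simp add: mult_le_0_iff)
  then have "l \<in> minimizers (composite f g)"
    using limit_le[OF X(2) l(1) v] by (simp add: minimizers_eq)
  then have "infdist x (minimizers (composite f g)) \<le> dist x l" by (rule infdist_le)
  then have "c * infdist x (minimizers (composite f g)) \<le> c * dist x l"
    using c(1) by simp
  also have "\<dots> \<le> sqrt (Fr x - Fmin)" using l(2) by (simp add: X_def)
  finally have "(c * infdist x (minimizers (composite f g)))\<^sup>2 \<le> (sqrt (Fr x - Fmin))\<^sup>2"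
    using c(1) by (intro power_mono) (auto simp: infdist_nonneg)
  then show "z * (\<nu> / 2 * (infdist x (minimizers (composite f g)))\<^sup>2) \<le> Fr x - Fmin"
    using Fmin_le[OF x(2)] by (simp add: power_mult_distrib c(2) mult_ac)
qed

lemma prox_PL_imp_prox_EB:
  assumes PL: "restricted_prox_PL f g L K \<nu>"
    and inv: "\<And>\<eta> x. 0 < \<eta> \<Longrightarrow> \<eta> \<le> 1 / L \<Longrightarrow> x \<in> K \<Longrightarrow> step \<eta> x \<in> K"
  shows "restricted_prox_EB f g L K (1 / L + 2 / \<nu>)"
  unfolding restricted_prox_EB_def effective_dom_composite
proof (intro conjI ballI)
  have \<nu>: "0 < \<nu>" using PL by (simp add: restricted_prox_PL_iff)
  then show "0 < 1 / L + 2 / \<nu>" using L_pos by (simp add: add_pos_pos)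
  fix x assume "x \<in> K \<inter> effective_dom g"
  then have x: "x \<in> K" "x \<in> effective_dom g" by auto
  define p G where "p = step (1 / L) x" and "G = norm (prox_grad_map f g (1 / L) x)"
  let ?d = "infdist p (minimizers (composite f g))"
  have p: "p \<in> K" "p \<in> effective_dom g"
    using inv[of "1 / L" x] step_in_dom[of "1 / L" x] x L_pos by (auto simp: p_def)
  \<comment> \<open>Growth and PL are both applied at \<open>p\<close>: \<nu>/2 d^2 is at most the
    gap, hence at most 2 G^2 / \<nu>, so d is at most 2 G / \<nu>. The step from \<open>x\<close> to
    \<open>p\<close> adds G / L.\<close>
  have "\<nu> / 2 * ?d\<^sup>2 \<le> Fr p - Fmin"
    using PL inv p by (rule quadratic_growth)
  also have "\<dots> \<le> grad_size (1 / L) p / (2 * \<nu>)"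
    using PL p \<nu> by (simp add: restricted_prox_PL_iff field_simps)
  also have "\<dots> \<le> 4 * G\<^sup>2 / (2 * \<nu>)"
    using grad_size_step_le[OF x(2)] \<nu> by (intro divide_right_mono) (auto simp: p_def G_def)
  finally have "?d\<^sup>2 \<le> (2 / \<nu> * G)\<^sup>2"
    using \<nu> by (simp add: field_simps power2_eq_square)
  then have d: "?d \<le> 2 / \<nu> * G"
    by (rule power2_le_imp_le) (use \<nu> in \<open>simp add: G_def\<close>)
  have "dist x p = 1 / L * G"
    using L_pos by (simp add: G_def p_def step_def prox_grad_map_def dist_norm)
  with d infdist_triangle[of x "minimizers (composite f g)" p]
  show "infdist x (minimizers (composite f g)) \<le> (1 / L + 2 / \<nu>) * norm (prox_grad_map f g (1 / L) x)"
    by (simp add: G_def distrib_right)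
qed

end

theorem theorem2:
  fixes f :: "'a::euclidean_space \<Rightarrow> real"
    and g :: "'a \<Rightarrow> ereal"
    and L :: real
    and K :: "'a set"
  assumes "0 < L"
    and "continuously_differentiable f"
    and "smooth_fun L f"
    and "proper_fun g"
    and "closed_fun g"
    and "convex_fun g"
    and "minimizers (composite f g) \<noteq> {}"
    and "\<bar>min_value (composite f g)\<bar> \<noteq> \<infinity>"
  shows "(\<forall>\<mu>. restricted_prox_EB f g L K \<mu> \<longrightarrow>
            restricted_prox_PL f g L K (L / (1 + 4 * L\<^sup>2 * \<mu>\<^sup>2))) \<and>
         (\<forall>\<nu>. restricted_prox_PL f g L K \<nu> \<and> closed K \<and>
            (\<forall>\<eta>. 0 < \<eta> \<and> \<eta> \<le> 1 / L \<longrightarrow>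
               (\<forall>x\<in>K. x - \<eta> *\<^sub>R prox_grad_map f g \<eta> x \<in> K)) \<longrightarrow>
            restricted_prox_EB f g L K (1 / L + 2 / \<nu>))"
proof -
  interpret composite_objective f g L
    using assms by unfold_locales
  have step_eq: "x - \<eta> *\<^sub>R prox_grad_map f g \<eta> x = step \<eta> x" if "0 < \<eta>" for \<eta> x
    using that by (simp add: prox_grad_map_def step_def)
  show ?thesis
    by (auto simp: step_eq intro: prox_EB_imp_prox_PL prox_PL_imp_prox_EB)
qed

end
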